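(* Let $F:\mathbf{C}\to\mathbf{D}$ be a (covariant) functor, let $(F,\mathbf{C},\mathbf{D})$ be the abstract graph of $F$, and let $P:(F,\mathbf{C},\mathbf{D})\to\mathbf{C}$ be the first projection functor, $P(X,FX)=X$ and $P(f,Ff)=f$. Then $P$ is a split fibration and a split opfibration.
   Context: The abstract graph $(F,\mathbf{C},\mathbf{D})$ of a functor $F:\mathbf{C}\to\mathbf{D}$ is the category whose objects are the pairs $(X,FX)$ with $X\in \mathrm{Ob}(\mathbf{C})$, whose morphisms $(X,FX)\to(Y,FY)$ are the pairs $(f,Ff)$ with $f:X\to Y$ in $\mathbf{C}$, with identities $(\mathrm{id}_X,\mathrm{id}_{FX})$ and composition $(g,Fg)\circ(f,Ff)=(g\circ f,Fg\circ Ff)$. Let $P:\mathbf{E}\to\mathbf{B}$ be a functor. A morphism $f:X\to Y$ in $\mathbf{E}$ is Cartesian over $u:I\to J$ in $\mathbf{B}$ if $Pf=u$ and for every $g:Z\to Y$ in $\mathbf{E}$ and every $w:PZ\to I$ with $Pg=u\circ w$ there is a unique $h:Z\to X$ in $\mathbf{E}$ with $Ph=w$ and $f\circ h=g$. $P$ is a fibration if for every $Y\in\mathbf{E}$ and $u:I\to PY$ in $\mathbf{B}$ there is a Cartesian morphism $X\to Y$ over $u$. A fibration is split if it admits a cleavage (a choice, for each such $u$ and $Y$, of a Cartesian morphism $\gamma(u,Y)$ over $u$ with codomain $Y$) such that $\gamma(\mathrm{id}_{PY},Y)=\mathrm{id}_Y$ and such that the composite of composable chosen lifts is the chosen lift of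 the composite: $\gamma(v,Z)\circ\gamma(u,Y)=\gamma(v\circ u,Z)$, where $Y$ is the domain of $\gamma(v,Z)$. Opcartesian morphisms, opfibrations and split opfibrations are the dual notions ($P$ is a split opfibration if and only if $P^{op}:\mathbf{E}^{op}\to\mathbf{B}^{op}$ is a split fibration). *)

theory Defs
  imports Main
begin

(* Composition is written in applicative order: Comp C g f is "g after f". The operations are
   constrained only on Obj C, on Arr C and on composable pairs of arrows. *)

record ('o, 'm) cat =
  Obj :: "'o set"
  Arr :: "'m set"
  Dom :: "'m \<Rightarrow> 'o"
  Cod :: "'m \<Rightarrow> 'o"
  Ident :: "'o \<Rightarrow> 'm"
  Comp :: "'m \<Rightarrow> 'm \<Rightarrow> 'm"

definition hom :: "('o, 'm) cat \<Rightarrow> 'o \<Rightarrow> 'o \<Rightarrow> 'm set" where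
  "hom C X Y = {f \<in> Arr C. Dom C f = X \<and> Cod C f = Y}"

locale category =
  fixes C :: "('o, 'm) cat"
  assumes dom_in_Obj: "f \<in> Arr C \<Longrightarrow> Dom C f \<in> Obj C"
    and cod_in_Obj: "f \<in> Arr C \<Longrightarrow> Cod C f \<in> Obj C"
    and ident_in_hom: "X \<in> Obj C \<Longrightarrow> Ident C X \<in> hom C X X"
    and comp_in_hom: "f \<in> hom C X Y \<Longrightarrow> g \<in> hom C Y Z \<Longrightarrow> Comp C g f \<in> hom C X Z"
    and comp_ident_right: "f \<in> hom C X Y \<Longrightarrow> Comp C f (Ident C X) = f"
    and comp_ident_left: "f \<in> hom C X Y \<Longrightarrow> Comp C (Ident C Y) f = f"
    and comp_assoc: "f \<in> hom C W X \<Longrightarrow> g \<in> hom C X Y \<Longrightarrow> h \<in> hom C Y Z \<Longrightarrow>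
           Comp C h (Comp C g f) = Comp C (Comp C h g) f"

definition op_cat :: "('o, 'm) cat \<Rightarrow> ('o, 'm) cat" where
  "op_cat C = \<lparr>Obj = Obj C, Arr = Arr C, Dom = Cod C, Cod = Dom C, Ident = Ident C,
     Comp = (\<lambda>g f. Comp C f g)\<rparr>"

(* The source and target categories are not part of the data, so the opposite of a functor is
   given by the same pair of maps, regarded between the opposite categories. *)

record ('oc, 'mc, 'od, 'md) fun_maps =
  ObjMap :: "'oc \<Rightarrow> 'od"
  ArrMap :: "'mc \<Rightarrow> 'md"

locale cat_functor = source: category C + target: category D
  for C :: "('oc, 'mc) cat" and D :: "('od, 'md) cat" +
  fixes F :: "('oc, 'mc, 'od, 'md) fun_maps"
  assumes obj_map: "X \<in> Obj C \<Longrightarrow> ObjMap F X \<in> Obj D"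
    and arr_map: "f \<in> hom C X Y \<Longrightarrow> ArrMap F f \<in> hom D (ObjMap F X) (ObjMap F Y)"
    and map_ident: "X \<in> Obj C \<Longrightarrow> ArrMap F (Ident C X) = Ident D (ObjMap F X)"
    and map_comp: "f \<in> hom C X Y \<Longrightarrow> g \<in> hom C Y Z \<Longrightarrow>
           ArrMap F (Comp C g f) = Comp D (ArrMap F g) (ArrMap F f)"

definition abstract_graph ::
  "('oc, 'mc, 'od, 'md) fun_maps \<Rightarrow> ('oc, 'mc) cat \<Rightarrow> ('od, 'md) cat
     \<Rightarrow> ('oc \<times> 'od, 'mc \<times> 'md) cat" where
  "abstract_graph F C D =
     \<lparr>Obj = {(X, ObjMap F X) | X. X \<in> Obj C},
      Arr = {(f, ArrMap F f) | f. f \<in> Arr C},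
      Dom = (\<lambda>(f, f'). (Dom C f, ObjMap F (Dom C f))),
      Cod = (\<lambda>(f, f'). (Cod C f, ObjMap F (Cod C f))),
      Ident = (\<lambda>(X, X'). (Ident C X, Ident D X')),
      Comp = (\<lambda>(g, g') (f, f'). (Comp C g f, Comp D g' f'))\<rparr>"

definition first_projection ::
  "('oc \<times> 'od, 'mc \<times> 'md, 'oc, 'mc) fun_maps" where
  "first_projection = \<lparr>ObjMap = fst, ArrMap = fst\<rparr>"

definition cartesian ::
  "('oe, 'me) cat \<Rightarrow> ('ob, 'mb) cat \<Rightarrow> ('oe, 'me, 'ob, 'mb) fun_maps
     \<Rightarrow> 'me \<Rightarrow> 'mb \<Rightarrow> bool" where
  "cartesian E B P f u \<longleftrightarrow>
     f \<in> Arr E \<and> u \<in> Arr B \<and> ArrMap P f = u \<and>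
     (\<forall>Z \<in> Obj E. \<forall>g \<in> hom E Z (Cod E f). \<forall>w \<in> hom B (ObjMap P Z) (Dom B u).
        ArrMap P g = Comp B u w \<longrightarrow>
        (\<exists>!h. h \<in> hom E Z (Dom E f) \<and> ArrMap P h = w \<and> Comp E f h = g))"

definition fibration ::
  "('oe, 'me) cat \<Rightarrow> ('ob, 'mb) cat \<Rightarrow> ('oe, 'me, 'ob, 'mb) fun_maps \<Rightarrow> bool" where
  "fibration E B P \<longleftrightarrow>
     cat_functor E B P \<and>
     (\<forall>Y \<in> Obj E. \<forall>I \<in> Obj B. \<forall>u \<in> hom B I (ObjMap P Y).
        \<exists>f. Cod E f = Y \<and> cartesian E B P f u)"

definition cleavage ::
  "('oe, 'me) cat \<Rightarrow> ('ob, 'mb) cat \<Rightarrow> ('oe, 'me, 'ob, 'mb) fun_maps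
     \<Rightarrow> ('mb \<Rightarrow> 'oe \<Rightarrow> 'me) \<Rightarrow> bool" where
  "cleavage E B P \<gamma> \<longleftrightarrow>
     (\<forall>Y \<in> Obj E. \<forall>I \<in> Obj B. \<forall>u \<in> hom B I (ObjMap P Y).
        Cod E (\<gamma> u Y) = Y \<and> cartesian E B P (\<gamma> u Y) u)"

definition split_cleavage ::
  "('oe, 'me) cat \<Rightarrow> ('ob, 'mb) cat \<Rightarrow> ('oe, 'me, 'ob, 'mb) fun_maps
     \<Rightarrow> ('mb \<Rightarrow> 'oe \<Rightarrow> 'me) \<Rightarrow> bool" where
  "split_cleavage E B P \<gamma> \<longleftrightarrow>
     cleavage E B P \<gamma> \<and>
     (\<forall>Y \<in> Obj E. \<gamma> (Ident B (ObjMap P Y)) Y = Ident E Y) \<and>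
     (\<forall>Z \<in> Obj E. \<forall>I \<in> Obj B. \<forall>J \<in> Obj B. \<forall>u \<in> hom B I J. \<forall>v \<in> hom B J (ObjMap P Z).
        Comp E (\<gamma> v Z) (\<gamma> u (Dom E (\<gamma> v Z))) = \<gamma> (Comp B v u) Z)"

definition split_fibration ::
  "('oe, 'me) cat \<Rightarrow> ('ob, 'mb) cat \<Rightarrow> ('oe, 'me, 'ob, 'mb) fun_maps \<Rightarrow> bool" where
  "split_fibration E B P \<longleftrightarrow> fibration E B P \<and> (\<exists>\<gamma>. split_cleavage E B P \<gamma>)"

definition opcartesian ::
  "('oe, 'me) cat \<Rightarrow> ('ob, 'mb) cat \<Rightarrow> ('oe, 'me, 'ob, 'mb) fun_maps
     \<Rightarrow> 'me \<Rightarrow> 'mb \<Rightarrow> bool" where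
  "opcartesian E B P f u \<longleftrightarrow> cartesian (op_cat E) (op_cat B) P f u"

definition opfibration ::
  "('oe, 'me) cat \<Rightarrow> ('ob, 'mb) cat \<Rightarrow> ('oe, 'me, 'ob, 'mb) fun_maps \<Rightarrow> bool" where
  "opfibration E B P \<longleftrightarrow> fibration (op_cat E) (op_cat B) P"

definition split_opfibration ::
  "('oe, 'me) cat \<Rightarrow> ('ob, 'mb) cat \<Rightarrow> ('oe, 'me, 'ob, 'mb) fun_maps \<Rightarrow> bool" where
  "split_opfibration E B P \<longleftrightarrow> split_fibration (op_cat E) (op_cat B) P"

lemma op_cat_simps [simp]:
  "Obj (op_cat C) = Obj C" "Arr (op_cat C) = Arr C"
  "Dom (op_cat C) = Cod C" "Cod (op_cat C) = Dom C"
  "Ident (op_cat C) = Ident C" "Comp (op_cat C) g f = Comp C f g"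
  by (simp_all add: op_cat_def)

lemma op_cat_op_cat [simp]: "op_cat (op_cat C) = C"
  by (cases C) (simp add: op_cat_def)

lemma hom_op_cat [simp]: "hom (op_cat C) X Y = hom C Y X"
  by (auto simp: hom_def)

lemma category_op_cat: assumes "category C" shows "category (op_cat C)"
proof -
  interpret category C by fact
  show ?thesis
    by unfold_locales
      (simp_all add: dom_in_Obj cod_in_Obj ident_in_hom comp_in_hom comp_ident_left
        comp_ident_right comp_assoc)
qed

lemma cat_functor_op_cat:
  assumes "cat_functor C D F" shows "cat_functor (op_cat C) (op_cat D) F"
proof -
  interpret cat_functor C D F by fact
  show ?thesis
    by (intro cat_functor.intro cat_functor_axioms.intro category_op_cat
        source.category_axioms target.category_axioms)
      (simp_all add: obj_map arr_map map_ident map_comp)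
qed

lemma cat_functor_op_cat_iff [simp]:
  "cat_functor (op_cat C) (op_cat D) F \<longleftrightarrow> cat_functor C D F"
  using cat_functor_op_cat[of C D F] cat_functor_op_cat[of "op_cat C" "op_cat D" F] by auto

lemma opcartesian_iff:
  "opcartesian E B P f u \<longleftrightarrow>
     f \<in> Arr E \<and> u \<in> Arr B \<and> ArrMap P f = u \<and>
     (\<forall>Z \<in> Obj E. \<forall>g \<in> hom E (Dom E f) Z. \<forall>w \<in> hom B (Cod B u) (ObjMap P Z).
        ArrMap P g = Comp B w u \<longrightarrow>
        (\<exists>!h. h \<in> hom E (Cod E f) Z \<and> ArrMap P h = w \<and> Comp E h f = g))"
  by (simp add: opcartesian_def cartesian_def)

lemma opfibration_iff:
  "opfibration E B P \<longleftrightarrow>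
     cat_functor E B P \<and>
     (\<forall>X \<in> Obj E. \<forall>J \<in> Obj B. \<forall>u \<in> hom B (ObjMap P X) J.
        \<exists>f. Dom E f = X \<and> opcartesian E B P f u)"
  by (simp add: opfibration_def fibration_def opcartesian_def)

lemma split_opfibration_iff:
  "split_opfibration E B P \<longleftrightarrow>
     opfibration E B P \<and>
     (\<exists>\<gamma>.
        (\<forall>X \<in> Obj E. \<forall>J \<in> Obj B. \<forall>u \<in> hom B (ObjMap P X) J.
           Dom E (\<gamma> u X) = X \<and> opcartesian E B P (\<gamma> u X) u) \<and>
        (\<forall>X \<in> Obj E. \<gamma> (Ident B (ObjMap P X)) X = Ident E X) \<and>
        (\<forall>X \<in> Obj E. \<forall>K \<in> Obj B. \<forall>J \<in> Obj B. \<forall>v \<in> hom B J K. \<forall>u \<in> hom B (ObjMap P X) J.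
           Comp E (\<gamma> v (Cod E (\<gamma> u X))) (\<gamma> u X) = \<gamma> (Comp B v u) X))"
  by (simp add: split_opfibration_def split_fibration_def opfibration_def split_cleavage_def
      cleavage_def opcartesian_def)

end

theory Submission
  imports Defs
begin

text \<open>The projection is an isomorphism of categories, so every arrow of the graph is Cartesian
  and \<open>(u, F u)\<close> is the only possible choice of lift of \<open>u\<close>. The opfibration half follows by
  duality, because the opposite of the graph of \<open>F\<close> is the graph of the opposite functor.\<close>

lemma abstract_graph_simps [simp]:
  "Obj (abstract_graph F C D) = (\<lambda>X. (X, ObjMap F X)) ` Obj C"
  "Arr (abstract_graph F C D) = (\<lambda>f. (f, ArrMap F f)) ` Arr C"
  "Dom (abstract_graph F C D) (f, f') = (Dom C f, ObjMap F (Dom C f))"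
  "Cod (abstract_graph F C D) (f, f') = (Cod C f, ObjMap F (Cod C f))"
  "Ident (abstract_graph F C D) (X, X') = (Ident C X, Ident D X')"
  "Comp (abstract_graph F C D) (g, g') (f, f') = (Comp C g f, Comp D g' f')"
  by (auto simp: abstract_graph_def)

lemma first_projection_simps [simp]:
  "ObjMap first_projection = fst" "ArrMap first_projection = fst"
  by (simp_all add: first_projection_def)

text \<open>\<open>Dom\<close> and \<open>Cod\<close> recompute both endpoints from the first
  component of \<open>p\<close>, so \<open>A\<close> and \<open>B\<close> need not be assumed to be
  objects.\<close>

lemma hom_abstract_graph_iff:
  "p \<in> hom (abstract_graph F C D) A B \<longleftrightarrow>
     (\<exists>f X Y. p = (f, ArrMap F f) \<and> A = (X, ObjMap F X) \<and> B = (Y, ObjMap F Y) \<and> f \<in> hom C X Y)"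
  by (auto simp: hom_def)

text \<open>An equality of records, not just an isomorphism: reversal acts alike on both components,
  and \<open>F\<close> does not record its source and target.\<close>

lemma op_cat_abstract_graph:
  "op_cat (abstract_graph F C D) = abstract_graph F (op_cat C) (op_cat D)"
  by (auto simp: op_cat_def abstract_graph_def fun_eq_iff)

lemma split_fibrationI:
  assumes "cat_functor E B P" and "split_cleavage E B P \<gamma>"
  shows "split_fibration E B P"
proof -
  have "cleavage E B P \<gamma>"
    using assms(2) by (simp add: split_cleavage_def)
  then have "fibration E B P"
    unfolding fibration_def cleavage_def using assms(1) by blast
  with assms(2) show ?thesis
    unfolding split_fibration_def by blast
qed

context cat_functor
begin

lemma category_abstract_graph: "category (abstract_graph F C D)"
proof
  fix f g h W X Y Z
  let ?G = "abstract_graph F C D"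
  show "f \<in> Arr ?G \<Longrightarrow> Dom ?G f \<in> Obj ?G"
    by (auto simp: source.dom_in_Obj)
  show "f \<in> Arr ?G \<Longrightarrow> Cod ?G f \<in> Obj ?G"
    by (auto simp: source.cod_in_Obj)
  \<comment> \<open>Closure under identities and composites is where functoriality of
    \<open>F\<close> enters.\<close>
  show "X \<in> Obj ?G \<Longrightarrow> Ident ?G X \<in> hom ?G X X"
    by (auto simp: hom_abstract_graph_iff source.ident_in_hom map_ident)
  show "f \<in> hom ?G X Y \<Longrightarrow> g \<in> hom ?G Y Z \<Longrightarrow> Comp ?G g f \<in> hom ?G X Z"
    by (auto simp: hom_abstract_graph_iff source.comp_in_hom map_comp)
  show "f \<in> hom ?G X Y \<Longrightarrow> Comp ?G f (Ident ?G X) = f"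
    by (auto simp: hom_abstract_graph_iff source.comp_ident_right target.comp_ident_right[OF arr_map])
  show "f \<in> hom ?G X Y \<Longrightarrow> Comp ?G (Ident ?G Y) f = f"
    by (auto simp: hom_abstract_graph_iff source.comp_ident_left target.comp_ident_left[OF arr_map])
  show "f \<in> hom ?G W X \<Longrightarrow> g \<in> hom ?G X Y \<Longrightarrow> h \<in> hom ?G Y Z \<Longrightarrow>
      Comp ?G h (Comp ?G g f) = Comp ?G (Comp ?G h g) f"
    by (auto simp: hom_abstract_graph_iff source.comp_assoc
        target.comp_assoc[OF arr_map arr_map arr_map])
qed

lemma cat_functor_first_projection: "cat_functor (abstract_graph F C D) C first_projection"
  by (intro cat_functor.intro cat_functor_axioms.intro category_abstract_graph
      source.category_axioms) (auto simp: hom_abstract_graph_iff)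

text \<open>A factorization over \<open>w\<close> can only be \<open>(w, ArrMap F w)\<close>. It
  works because \<open>g\<close> is determined by its first component \<open>Comp C u w\<close> and
  \<open>F\<close> preserves composites.\<close>

lemma cartesian_first_projection:
  assumes "u \<in> Arr C"
  shows "cartesian (abstract_graph F C D) C first_projection (u, ArrMap F u) u"
proof -
  have u: "u \<in> hom C (Dom C u) (Cod C u)"
    using assms by (simp add: hom_def)
  show ?thesis
    using assms by (auto simp: cartesian_def hom_abstract_graph_iff map_comp[OF _ u])
qed

text \<open>The choice may ignore \<open>Y\<close>: as an object of the graph, \<open>Y\<close> is
  determined by the codomain of \<open>u\<close>. The two splitting laws are
  \<open>map_ident\<close> and \<open>map_comp\<close>.\<close>

lemma split_cleavage_first_projection:
  "split_cleavage (abstract_graph F C D) C first_projection (\<lambda>u Y. (u, ArrMap F u))"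
  unfolding split_cleavage_def cleavage_def
  by (auto simp: cartesian_first_projection map_ident map_comp)
    (auto simp: hom_def cartesian_first_projection)

lemma split_fibration_first_projection:
  "split_fibration (abstract_graph F C D) C first_projection"
  by (rule split_fibrationI[OF cat_functor_first_projection split_cleavage_first_projection])

end

theorem proposition4:
  fixes C :: "('oc, 'mc) cat" and D :: "('od, 'md) cat"
    and F :: "('oc, 'mc, 'od, 'md) fun_maps"
  assumes "cat_functor C D F"
  shows "split_fibration (abstract_graph F C D) C first_projection
       \<and> split_opfibration (abstract_graph F C D) C first_projection"
  using cat_functor.split_fibration_first_projection[OF assms]
    \<comment> \<open>The fibration half for \<open>F\<close> as a functor between the opposite
      categories; \<open>op_cat_abstract_graph\<close> identifies its graph with the opposite
      graph.\<close>
    cat_functor.split_fibration_first_projection[OF cat_functor_op_cat[OF assms]]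
  by (simp add: split_opfibration_def op_cat_abstract_graph)

end
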